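(* For every prime power $q>7$, $$M(q+1,q-4)\ \ge\ \mathcal{T}_3(q)+\max\{N^m_{3,2}(q),\,N_{3,0}(q)\}.$$
   Context: For permutations $\pi,\sigma$ of the same $n$ symbols, the Hamming distance $hd(\pi,\sigma)$ is the number of positions $x$ with $\pi(x)\ne\sigma(x)$. $M(n,D)$ is the maximum size of a set of permutations on $n$ symbols in which any two distinct permutations have Hamming distance at least $D$. Let $q$ be a prime power, $\mathbb{F}_q$ the field with $q$ elements and $\mathcal{P}^1(\mathbb{F}_q)=\mathbb{F}_q\cup\{\infty\}$. Let $V,U$ be nonzero polynomials over $\mathbb{F}_q$ with $\gcd(V,U)=1$, of degrees $v,u$ and leading coefficients $a_v,b_u$. The rational function $V(x)/U(x)$ is evaluated on $\mathcal{P}^1(\mathbb{F}_q)$ as follows: at $a\in\mathbb{F}_q$ its value is $V(a)/U(a)$, understood as $\infty$ if $U(a)=0$; at $\infty$ its value is $\infty$ if $v>u$, $0$ if $v<u$, and $a_v/b_v$ if $v=u$. It is a permutation rational function (PRF) if it permutes $\mathcal{P}^1(\mathbb{F}_q)$. $P_{v,u}(q)$ is the set of PRFs $V(x)/U(x)$ (as rational functions, so $V/U$ and $(cV)/(cU)$ with $c\in\mathbb{F}_q\setminus\{0\}$ are the same element) with $\deg V=v$ and $\deg U=u$, and $N_{v,u}(q)=|P_{v,u}(q)|$. $N^m_{v,u}(q)$ is the number of PRFs $V(x)/U(x)$ in $P_{v,u}(q)$ with both $V$ and $U$ monic. $\mathcal{T}_3(q)=\sum N_{v,u}(q)$, the sum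 being over all pairs $(v,u)$ with $0\le v,u\le 2$. *)

theory Defs
  imports
    "HOL-Computational_Algebra.Polynomial"
    "HOL-Computational_Algebra.Fraction_Field"
    "HOL-Combinatorics.Permutations"
    "HOL-Library.Cardinality"
begin

definition hamming_dist :: "nat \<Rightarrow> (nat \<Rightarrow> nat) \<Rightarrow> (nat \<Rightarrow> nat) \<Rightarrow> nat" where
  "hamming_dist n p s = card {x \<in> {..<n}. p x \<noteq> s x}"

definition perm_array :: "nat \<Rightarrow> nat \<Rightarrow> (nat \<Rightarrow> nat) set \<Rightarrow> bool" where
  "perm_array n D A \<longleftrightarrow>
     (\<forall>p\<in>A. p permutes {..<n}) \<and>
     (\<forall>p\<in>A. \<forall>s\<in>A. p \<noteq> s \<longrightarrow> hamming_dist n p s \<ge> D)"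

(* There are finitely many permutations of {..<n}, so Max ranges over a finite set; it is
   nonempty because of A = {}. *)
definition max_perm_array :: "nat \<Rightarrow> nat \<Rightarrow> nat" where
  "max_perm_array n D = Max {card A | A. perm_array n D A}"

(* The projective line over the field 'a is encoded as 'a option, with None for infinity. *)
fun eval_ratfun :: "'a::field poly \<Rightarrow> 'a poly \<Rightarrow> 'a option \<Rightarrow> 'a option" where
  "eval_ratfun V U (Some a) = (if poly U a = 0 then None else Some (poly V a / poly U a))"
| "eval_ratfun V U None =
     (if degree V > degree U then None
      else if degree V < degree U then Some 0
      else Some (lead_coeff V / lead_coeff U))"

definition is_PRF :: "'a::field poly \<Rightarrow> 'a poly \<Rightarrow> bool" where
  "is_PRF V U \<longleftrightarrow> V \<noteq> 0 \<and> U \<noteq> 0 \<and> coprime V U \<and> bij (eval_ratfun V U)"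

(* Elements are taken in the fraction field of 'a[x], which identifies V/U with (cV)/(cU). *)
definition PRFs :: "nat \<Rightarrow> nat \<Rightarrow> 'a::field poly fract set" where
  "PRFs v u = {Fract V U | V U. is_PRF V U \<and> degree V = v \<and> degree U = u}"

definition monic_PRFs :: "nat \<Rightarrow> nat \<Rightarrow> 'a::field poly fract set" where
  "monic_PRFs v u =
     {Fract V U | V U. is_PRF V U \<and> degree V = v \<and> degree U = u \<and>
        lead_coeff V = 1 \<and> lead_coeff U = 1}"

definition num_PRFs :: "'a::{field,finite} itself \<Rightarrow> nat \<Rightarrow> nat \<Rightarrow> nat" where
  "num_PRFs F v u = card (PRFs v u :: 'a poly fract set)"

definition num_monic_PRFs :: "'a::{field,finite} itself \<Rightarrow> nat \<Rightarrow> nat \<Rightarrow> nat" where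
  "num_monic_PRFs F v u = card (monic_PRFs v u :: 'a poly fract set)"

definition T3 :: "'a::{field,finite} itself \<Rightarrow> nat" where
  "T3 F = (\<Sum>v\<le>2. \<Sum>u\<le>2. num_PRFs F v u)"

end

(* Two distinct fractions V/U and R/S agree at a finite point only if it is a root of the nonzero
   polynomial V*S - R*U, so they agree in at most deg (V*S - R*U) points, plus possibly infinity.
   If both numerators and denominators have degree at most 2, this gives at most 4 + 1 points.
   If V/U has numerator of degree 3 and denominator of degree at most 2, then it fixes infinity;
   R/S with degrees at most 2 agrees with it there only if deg S < deg R, which lowers the degree
   of V*S - R*U from 5 to 4.  Two monic fractions of type (3,2) both fix infinity, but the leading
   terms of V*S and R*U cancel, which again leaves degree 4; two polynomials of degree 3 agree in
   at most 3 + 1 points.  Hence no two of the permutations agree in more than 5 of the q + 1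
   points. *)
theory Submission
  imports Defs
begin

section \<open>Permutation arrays from families of bijections\<close>

lemma card_le_max_perm_array:
  assumes "perm_array n D A"
  shows "card A \<le> max_perm_array n D"
proof -
  have "{card A |A. perm_array n D A} \<subseteq> card ` Pow {p. p permutes {..<n}}"
    by (auto simp: perm_array_def)
  moreover have "finite (Pow {p. p permutes {..<n}})"
    by (simp add: finite_permutations)
  ultimately have "finite {card A |A. perm_array n D A}"
    by (meson finite_imageI finite_subset)
  then show ?thesis
    unfolding max_perm_array_def using assms by (intro Max_ge) auto
qed

text \<open>Numbering the points of \<open>'b\<close> turns agreement in at most \<open>k\<close>
  points into Hamming distance at least \<open>CARD('b) - k\<close>. As \<open>k < CARD('b)\<close>,
  this distance is positive, so distinct indices yield distinct permutations.\<close>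

lemma card_le_max_perm_array_of_bijections:
  fixes E :: "'i \<Rightarrow> 'b::finite \<Rightarrow> 'b"
  assumes bij: "\<And>f. f \<in> S \<Longrightarrow> bij (E f)"
    and agree: "\<And>f g. f \<in> S \<Longrightarrow> g \<in> S \<Longrightarrow> f \<noteq> g \<Longrightarrow> card {x. E f x = E g x} \<le> k"
    and k: "k < CARD('b)"
  shows "finite S" "card S \<le> max_perm_array CARD('b) (CARD('b) - k)"
proof -
  let ?n = "CARD('b)"
  obtain h :: "'b \<Rightarrow> nat" where h: "bij_betw h UNIV {..<?n}"
    using ex_bij_betw_finite_nat[of "UNIV :: 'b set"] by (auto simp: lessThan_atLeast0)
  have inj_h: "inj h" and range_h: "range h = {..<?n}"
    using h by (auto simp: bij_betw_def)
  \<comment> \<open>\<open>E f\<close> conjugated by the numbering, with the identity outside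
    \<open>{..<?n}\<close> as \<open>permutes\<close> demands.\<close>
  define P where "P f x = (if x < ?n then h (E f (inv h x)) else x)" for f x
  have P_h: "P f (h y) = h (E f y)" for f y
    using range_h by (auto simp: P_def inv_f_f[OF inj_h])
  have permutes: "P f permutes {..<?n}" if "f \<in> S" for f
  proof (rule bij_imp_permutes)
    have "bij_betw (h \<circ> E f \<circ> inv h) {..<?n} {..<?n}"
      using bij[OF that] h bij_betw_inv_into[OF h] by (intro bij_betw_trans)
    then show "bij_betw (P f) {..<?n} {..<?n}"
      by (rule bij_betw_cong[THEN iffD1, rotated]) (simp add: P_def)
  qed (simp add: P_def)
  have dist: "hamming_dist ?n (P f) (P g) = ?n - card {x. E f x = E g x}" for f g
  proof -
    have "{x \<in> {..<?n}. P f x \<noteq> P g x} = h ` {y. E f y \<noteq> E g y}"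
      unfolding range_h[symmetric] by (auto simp: P_h inj_eq[OF inj_h])
    then have "hamming_dist ?n (P f) (P g) = card {y. E f y \<noteq> E g y}"
      by (simp add: hamming_dist_def card_image inj_on_subset[OF inj_h])
    also have "{y. E f y \<noteq> E g y} = UNIV - {y. E f y = E g y}"
      by auto
    finally show ?thesis
      by (simp add: card_Diff_subset)
  qed
  have far: "hamming_dist ?n (P f) (P g) \<ge> ?n - k" if "f \<in> S" "g \<in> S" "f \<noteq> g" for f g
    using agree[OF that] by (simp add: dist)
  have inj: "inj_on P S"
  proof (rule inj_onI, rule ccontr)
    fix f g assume fg: "f \<in> S" "g \<in> S" "P f = P g" "f \<noteq> g"
    then show False
      using far[of f g] k by (simp add: hamming_dist_def)
  qed
  have "finite (P ` S)"
    using permutes by (intro finite_subset[OF _ finite_permutations[of "{..<?n}"]]) auto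
  then show "finite S"
    using inj by (rule finite_imageD)
  have "perm_array ?n (?n - k) (P ` S)"
    unfolding perm_array_def using permutes far by auto
  from card_le_max_perm_array[OF this]
  show "card S \<le> max_perm_array ?n (?n - k)"
    by (simp add: card_image[OF inj])
qed

section \<open>Points of agreement of two rational functions\<close>

lemma card_eval_ratfun_agree_le:
  fixes V U R S :: "'a::field poly"
  assumes "V * S \<noteq> R * U"
  shows "card {x. eval_ratfun V U x = eval_ratfun R S x} \<le>
    degree (V * S - R * U) + of_bool (eval_ratfun V U None = eval_ratfun R S None)"
proof -
  let ?p = "V * S - R * U" and ?agree = "{x. eval_ratfun V U x = eval_ratfun R S x}"
  let ?inf = "{x :: 'a option. x = None \<and> eval_ratfun V U None = eval_ratfun R S None}"
  have p: "?p \<noteq> 0"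
    using assms by simp
  \<comment> \<open>If both values at \<open>Some a\<close> are infinite, then \<open>U\<close> and
    \<open>S\<close> vanish at \<open>a\<close>, and so do both products; if both are finite,
    cross-multiplying gives the root.\<close>
  have "x \<in> Some ` {a. poly ?p a = 0} \<union> ?inf" if "x \<in> ?agree" for x
    using that by (cases x) (auto simp: field_simps split: if_splits)
  then have sub: "?agree \<subseteq> Some ` {a. poly ?p a = 0} \<union> ?inf"
    by blast
  have fin: "finite {a. poly ?p a = 0}"
    using poly_roots_finite[OF p] .
  have "card ?agree \<le> card (Some ` {a. poly ?p a = 0} \<union> ?inf)"
    using sub fin by (intro card_mono) auto
  also have "\<dots> \<le> card (Some ` {a. poly ?p a = 0}) + card ?inf"
    by (rule card_Un_le)
  also have "card (Some ` {a. poly ?p a = 0}) = card {a. poly ?p a = 0}"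
    by (simp add: card_image)
  also have "\<dots> \<le> degree ?p"
    using card_poly_roots_bound[OF p] .
  also have "card ?inf = of_bool (eval_ratfun V U None = eval_ratfun R S None)"
    by (cases "eval_ratfun V U None = eval_ratfun R S None") (simp_all del: eval_ratfun.simps)
  finally show ?thesis
    by simp
qed

section \<open>Degrees of reduced fractions\<close>

text \<open>Euclid's algorithm: a relation for \<open>b\<close> and \<open>a mod b\<close> turns
  into one for \<open>a\<close> and \<open>b\<close>. At \<open>b = 0\<close> coprimality makes
  \<open>a\<close> a unit.\<close>

lemma coprime_imp_bezout:
  fixes a b :: "'a::euclidean_ring"
  assumes "coprime a b"
  shows "\<exists>x y. x * a + y * b = 1"
  using assms
proof (induction "euclidean_size b" arbitrary: a b rule: less_induct)
  case less
  show ?case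
  proof (cases "b = 0")
    case True
    then have "a dvd 1"
      using less.prems by simp
    then show ?thesis
      using True by (auto simp: dvd_def mult.commute)
  next
    case False
    have "coprime b (a mod b)"
      using less.prems by (meson coprime_def dvd_mod_iff)
    with less.hyps[OF mod_size_less[OF False]]
    obtain x y where "x * b + y * (a mod b) = 1"
      by blast
    then have "y * a + (x - y * (a div b)) * b = 1"
      by (simp add: minus_div_mult_eq_mod[symmetric] algebra_simps)
    then show ?thesis
      by blast
  qed
qed

lemma coprime_dvd_multD:
  fixes a b :: "'a::euclidean_ring"
  assumes "coprime a b" "a dvd c * b"
  shows "a dvd c"
proof -
  obtain x y where "x * a + y * b = 1"
    using coprime_imp_bezout[OF assms(1)] by blast
  then have "c = c * (x * a + y * b)"
    by simp
  also have "\<dots> = c * x * a + y * (c * b)"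
    by (simp add: algebra_simps)
  also have "a dvd \<dots>"
    using assms(2) by (intro dvd_add dvd_mult[of a "c * b" y]) simp_all
  finally show ?thesis .
qed

text \<open>Both fractions are reduced, so the numerators divide each other and have equal degree;
  comparing the degrees of the two products then settles the denominators.\<close>

lemma coprime_cross_mult_degree_eq:
  fixes V U R S :: "'a::field poly"
  assumes "coprime V U" "coprime R S" "V * S = R * U"
    and "V \<noteq> 0" "U \<noteq> 0" "R \<noteq> 0" "S \<noteq> 0"
  shows "degree V = degree R" "degree U = degree S"
proof -
  have "V dvd R"
    using assms(1,3) by (intro coprime_dvd_multD[of V U R]) (auto dest: sym)
  moreover have "R dvd V"
    using assms(2,3) by (intro coprime_dvd_multD[of R S V]) auto
  ultimately show R: "degree V = degree R"
    using assms(4,6) by (intro antisym dvd_imp_degree_le)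
  have "degree (V * S) = degree (R * U)"
    using assms(3) by simp
  then show "degree U = degree S"
    using R assms(4-7) by (simp add: degree_mult_eq)
qed

text \<open>This lets the sum in \<open>T3\<close> be read as the cardinality of a union of sets of
  fractions.\<close>

lemma PRFs_disjoint:
  assumes "(v, u) \<noteq> (v', u')"
  shows "PRFs v u \<inter> PRFs v' u' = {}"
proof -
  have "(degree V, degree U) = (degree R, degree S)"
    if "is_PRF V U" "is_PRF R S" "Fract V U = Fract R S" for V U R S :: "'a poly"
    using that coprime_cross_mult_degree_eq[of V U R S] by (simp add: is_PRF_def eq_fract)
  then show ?thesis
    using assms unfolding PRFs_def by blast
qed

section \<open>Agreement bounds by degree type\<close>

lemma degree_cross_diff_le:
  fixes V U R S :: "'a::comm_ring poly"
  assumes "degree V + degree S \<le> n" "degree R + degree U \<le> n"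
  shows "degree (V * S - R * U) \<le> n"
  using assms degree_mult_le[of V S] degree_mult_le[of R U] by (intro degree_diff_le) linarith+

lemma agree_le_small:
  fixes V U R S :: "'a::field poly"
  assumes "degree V \<le> 2" "degree U \<le> 2" "degree R \<le> 2" "degree S \<le> 2" "V * S \<noteq> R * U"
  shows "card {x. eval_ratfun V U x = eval_ratfun R S x} \<le> 5"
proof -
  have "degree (V * S - R * U) \<le> 4"
    using assms by (intro degree_cross_diff_le) auto
  then show ?thesis
    using card_eval_ratfun_agree_le[OF assms(5)] by (simp add: of_bool_def split: if_splits)
qed

lemma agree_le_cubic_small:
  fixes V U R S :: "'a::field poly"
  assumes "degree V = 3" "degree U \<le> 2" "degree R \<le> 2" "degree S \<le> 2" "V * S \<noteq> R * U"
  shows "card {x. eval_ratfun V U x = eval_ratfun R S x} \<le> 5"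
proof (cases "degree S < degree R")
  case True
  \<comment> \<open>Here \<open>degree S \<le> 1\<close>, so the products have degrees at most 3 + 1
    and 2 + 2.\<close>
  then have "degree (V * S - R * U) \<le> 4"
    using assms by (intro degree_cross_diff_le) auto
  then show ?thesis
    using card_eval_ratfun_agree_le[OF assms(5)] by (simp add: of_bool_def split: if_splits)
next
  case False
  then have "eval_ratfun V U None \<noteq> eval_ratfun R S None"
    using assms by simp
  moreover have "degree (V * S - R * U) \<le> 5"
    using assms by (intro degree_cross_diff_le) auto
  ultimately show ?thesis
    using card_eval_ratfun_agree_le[OF assms(5)] by (simp add: of_bool_def split: if_splits)
qed

lemma agree_le_monic_cubic:
  fixes V U R S :: "'a::field poly"
  assumes "degree V = 3" "degree U = 2" "degree R = 3" "degree S = 2"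
    and "lead_coeff V = 1" "lead_coeff U = 1" "lead_coeff R = 1" "lead_coeff S = 1"
    and "V * S \<noteq> R * U"
  shows "card {x. eval_ratfun V U x = eval_ratfun R S x} \<le> 5"
proof -
  have "degree (V * S - R * U) \<le> 5"
    using assms by (intro degree_cross_diff_le) auto
  \<comment> \<open>Both products are monic of degree 3 + 2 = 5.\<close>
  moreover have "coeff (V * S - R * U) 5 = 0"
    using assms coeff_mult_degree_sum[of V S] coeff_mult_degree_sum[of R U] by simp
  ultimately have "degree (V * S - R * U) \<noteq> 5"
    using assms(9) by (metis leading_coeff_0_iff right_minus_eq)
  with \<open>degree (V * S - R * U) \<le> 5\<close> have "degree (V * S - R * U) \<le> 4"
    by linarith
  then show ?thesis
    using card_eval_ratfun_agree_le[OF assms(9)] by (simp add: of_bool_def split: if_splits)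
qed

lemma agree_le_cubic_polynomial:
  fixes V U R S :: "'a::field poly"
  assumes "degree V = 3" "degree U = 0" "degree R = 3" "degree S = 0" "V * S \<noteq> R * U"
  shows "card {x. eval_ratfun V U x = eval_ratfun R S x} \<le> 5"
proof -
  have "degree (V * S - R * U) \<le> 3"
    using assms by (intro degree_cross_diff_le) auto
  then show ?thesis
    using card_eval_ratfun_agree_le[OF assms(5)] by (simp add: of_bool_def split: if_splits)
qed

section \<open>Counting the combined family\<close>

text \<open>The predicate \<open>B\<close> selects the cubic representatives, so that one argument
  serves both the monic fractions of type (3,2) and the cubic polynomials.\<close>

lemma T3_add_card_le:
  fixes B :: "'a::{field,finite} poly \<Rightarrow> 'a poly \<Rightarrow> bool"
  assumes q: "CARD('a) > 4"
    and C: "C = {Fract V U | V U. is_PRF V U \<and> B V U}"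
    and deg: "\<And>V U. B V U \<Longrightarrow> degree V = 3 \<and> degree U = u"
    and u: "u \<le> 2"
    and agree: "\<And>V U R S. B V U \<Longrightarrow> B R S \<Longrightarrow> V * S \<noteq> R * U \<Longrightarrow>
      card {x. eval_ratfun V U x = eval_ratfun R S x} \<le> 5"
  shows "T3 TYPE('a) + card C \<le> max_perm_array (CARD('a) + 1) (CARD('a) - 4)"
proof -
  define I where "I = {..2::nat} \<times> {..2::nat}"
  define T where "T = (\<Union>(v, u)\<in>I. PRFs v u :: 'a poly fract set)"
  let ?Q = "\<lambda>V U. degree V \<le> 2 \<and> degree U \<le> 2 \<or> B V U"
  have "\<forall>f\<in>T \<union> C. \<exists>V U. f = Fract V U \<and> is_PRF V U \<and> ?Q V U"
    unfolding T_def I_def C PRFs_def by fastforce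
  \<comment> \<open>Monicity belongs to a representative and not to a fraction, so the chosen
    \<open>N f\<close> and \<open>D f\<close> have to carry \<open>?Q\<close> along.\<close>
  then obtain N D where ND: "f = Fract (N f) (D f)" "is_PRF (N f) (D f)" "?Q (N f) (D f)"
    if "f \<in> T \<union> C" for f
    by metis
  have cross: "N f * D g \<noteq> N g * D f" if "f \<in> T \<union> C" "g \<in> T \<union> C" "f \<noteq> g" for f g
    using ND(1,2)[OF that(1)] ND(1,2)[OF that(2)] that(3) eq_fract(1)[of "D f" "D g" "N f" "N g"]
    by (auto simp: is_PRF_def)
  have Q_agree: "card {x. eval_ratfun V U x = eval_ratfun R S x} \<le> 5"
    if "?Q V U" "?Q R S" "V * S \<noteq> R * U" for V U R S
    using that(1)
  proof
    assume VU: "B V U"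
    from that(2) show ?thesis
      using VU deg[OF VU] u that(3) agree[OF VU] agree_le_cubic_small[of V U R S] by auto
  next
    assume VU: "degree V \<le> 2 \<and> degree U \<le> 2"
    from that(2) show ?thesis
    proof
      assume RS: "B R S"
      \<comment> \<open>The cubic fraction comes first in \<open>agree_le_cubic_small\<close>, so
        the two fractions trade places.\<close>
      then show ?thesis
        using VU deg[OF RS] u that(3) agree_le_cubic_small[of R S V U] by (simp add: eq_commute)
    qed (use VU that(3) agree_le_small[of V U R S] in auto)
  qed
  note bound = card_le_max_perm_array_of_bijections
    [where E = "\<lambda>f. eval_ratfun (N f) (D f)" and S = "T \<union> C" and k = 5]
  \<comment> \<open>The fraction field is infinite; finiteness comes from the injection into
    permutations, and the cardinalities of the unions below rest on it.\<close>
  have fin: "finite (T \<union> C)"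
    using ND(2) cross ND(3) q by (intro bound(1) Q_agree) (auto simp: is_PRF_def)
  \<comment> \<open>The projective line has \<open>CARD('a) + 1\<close> points, and removing the 5
    possible agreements leaves \<open>CARD('a) - 4\<close>.\<close>
  have "card (T \<union> C) \<le> max_perm_array CARD('a option) (CARD('a option) - 5)"
    using ND(2) cross ND(3) q by (intro bound(2) Q_agree) (auto simp: is_PRF_def)
  then have le: "card (T \<union> C) \<le> max_perm_array (CARD('a) + 1) (CARD('a) - 4)"
    by simp
  have "finite (PRFs v u :: 'a poly fract set)" if "(v, u) \<in> I" for v u
    using fin that by (intro finite_subset[OF _ fin]) (auto simp: T_def)
  moreover have "PRFs (fst i) (snd i) \<inter> PRFs (fst j) (snd j) = ({} :: 'a poly fract set)"
    if "i \<noteq> j" for i j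
    using that by (intro PRFs_disjoint) (simp add: prod_eq_iff)
  ultimately have "card T = (\<Sum>(v, u)\<in>I. card (PRFs v u :: 'a poly fract set))"
    unfolding T_def case_prod_unfold by (intro card_UN_disjoint) (auto simp: I_def)
  then have "card T = T3 TYPE('a)"
    by (simp add: T3_def num_PRFs_def I_def sum.cartesian_product)
  moreover have "T \<inter> C = {}"
  proof -
    have "C \<subseteq> PRFs 3 u"
      unfolding C PRFs_def using deg by blast
    moreover have "PRFs v w \<inter> PRFs 3 u = ({} :: 'a poly fract set)" if "(v, w) \<in> I" for v w
      using that by (intro PRFs_disjoint) (auto simp: I_def)
    ultimately show ?thesis
      unfolding T_def by blast
  qed
  ultimately show ?thesis
    using le fin by (simp add: card_Un_disjoint)
qed

theorem theorem3p11:
  fixes q :: nat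
  assumes "CARD('a::{field,finite}) = q"
    and "q > 7"
  shows "max_perm_array (q + 1) (q - 4) \<ge>
     T3 TYPE('a) + max (num_monic_PRFs TYPE('a) 3 2) (num_PRFs TYPE('a) 3 0)"
proof -
  \<comment> \<open>The maximum equals one of its arguments, so bounding the sum with each of them
    suffices.\<close>
  have "T3 TYPE('a) + num_monic_PRFs TYPE('a) 3 2 \<le> max_perm_array (CARD('a) + 1) (CARD('a) - 4)"
    unfolding num_monic_PRFs_def using assms agree_le_monic_cubic
    by (intro T3_add_card_le[OF _ monic_PRFs_def, where u = 2]) auto
  moreover have "T3 TYPE('a) + num_PRFs TYPE('a) 3 0 \<le> max_perm_array (CARD('a) + 1) (CARD('a) - 4)"
    unfolding num_PRFs_def using assms agree_le_cubic_polynomial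
    by (intro T3_add_card_le[OF _ PRFs_def, where u = 0]) auto
  ultimately show ?thesis
    using assms by (simp add: max_def)
qed

end
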